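(* Let $(X,\rho)$ be a metric space of finite diameter, $Y\subsetneq X$ a nonempty proper subset, $\varepsilon>0$, and $B_\varepsilon(x)=\{y\in X:\rho(x,y)<\varepsilon\}$. Assume that the collection $(X,Y,\{B_\varepsilon(x):x\in Y\})$ is admissible. Fix $\mu\in(0,1)$ and $f,F:X\to\mathbb{R}$ such that \[ \sup_X|F|+\sup_X|f|<\infty\qquad\text{and}\qquad \inf_Y f>0 . \] Then there exists $u:X\to\mathbb{R}$ such that $u_k$ converges uniformly on $X$ to $u$ as $k\to\infty$ for any sequence of functions $u_k:X\to\mathbb{R}$, $k\in\mathbb{N}_0$, with $\sup_X|u_0|<\infty$ and, for all $k\in\mathbb{N}_0$, \[ \begin{cases} u_{k+1}(x)=\mu\sup\limits_{B_\varepsilon(x)}u_k+(1-\mu)\inf\limits_{B_\varepsilon(x)}u_k+f(x) & \text{if } x\in Y,\\ u_{k+1}(x)=F(x) & \text{if } x\in X\setminus Y. \end{cases} \] (The limit $u$ does not depend on the choice of $u_0$.)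
   Context: Admissibility: the collection $(X,Y,\{B_\varepsilon(x):x\in Y\})$ is admissible if $X$, $Y$, $X\setminus Y$ and all $B_\varepsilon(x)$ are nonempty, and there is a finite integer $D\in\mathbb{N}$ such that for every $x\in Y$ there are $d=d(x)<D$ and a chain $x_0,\dots,x_d\in X$ with $x_0=x$, $x_d\in X\setminus Y$ and $x_i\in B_\varepsilon(x_{i-1})$ for all $i\in\{1,\dots,d\}$. *)

theory Defs
  imports "HOL-Analysis.Analysis"
begin

(* The family B is indexed by Y: its values outside Y are irrelevant, because a chain may be
   cut at its first point outside Y. *)
definition admissible :: "'a set \<Rightarrow> 'a set \<Rightarrow> ('a \<Rightarrow> 'a set) \<Rightarrow> bool" where
  "admissible X Y B \<longleftrightarrow>
     X \<noteq> {} \<and> Y \<noteq> {} \<and> X - Y \<noteq> {} \<and> (\<forall>x\<in>Y. B x \<noteq> {}) \<and>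
     (\<exists>D::nat. \<forall>x\<in>Y. \<exists>d<D. \<exists>c::nat \<Rightarrow> 'a.
        (\<forall>i\<le>d. c i \<in> X) \<and> c 0 = x \<and> c d \<in> X - Y \<and>
        (\<forall>i\<in>{1..d}. c i \<in> B (c (i - 1))))"

(* Real-valued functions on X are total functions whose values outside X play no role.
   SUP and INF are those of the reals, hence only meaningful on bounded nonempty sets; this holds
   for all terms of such a sequence when u 0, f and F are bounded on X. *)
definition dpp_iteration ::
  "'a set \<Rightarrow> 'a set \<Rightarrow> ('a \<Rightarrow> 'a set) \<Rightarrow> real \<Rightarrow> ('a \<Rightarrow> real) \<Rightarrow> ('a \<Rightarrow> real) \<Rightarrow>
   (nat \<Rightarrow> 'a \<Rightarrow> real) \<Rightarrow> bool" where
  "dpp_iteration X Y B \<mu> f F u \<longleftrightarrow>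
     (\<forall>k. (\<forall>x\<in>Y. u (Suc k) x =
              \<mu> * (SUP y\<in>B x. u k y) + (1 - \<mu>) * (INF y\<in>B x. u k y) + f x) \<and>
          (\<forall>x\<in>X - Y. u (Suc k) x = F x))"

end

theory Submission
  imports Defs
begin

text \<open>
  Write \<open>T\<close> for the operator with \<open>U (Suc k) = T (U k)\<close>. It is monotone, and adding a constant to
  its argument adds the same constant to its value on \<open>Y\<close>, so it is nonexpansive in the supremum
  norm, but it need not be a contraction. What makes the iteration converge is that \<open>f\<close> is bounded
  below on \<open>Y\<close> by some \<open>c > 0\<close>. The suprema and infima are positively homogeneous, so if \<open>V\<close> is an
  iteration with source \<open>f\<close> and \<open>t > 0\<close>, then on \<open>Y\<close> also \<open>(1 + t) V\<close> is one, with source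
  \<open>(1 + t) f \<ge> f + t c\<close>. Hence on \<open>Y\<close> the difference \<open>U (k + 1) - (1 + t) V (k + 1)\<close> is at least \<open>t c\<close>
  below the supremum of \<open>U k - (1 + t) V k\<close> over \<open>X\<close>, while on \<open>X - Y\<close> it is at most \<open>t sup |F|\<close>. This
  supremum therefore decreases by at least \<open>t c\<close> in each step until it is at most \<open>t sup |F|\<close>. If all
  functions are bounded by \<open>K\<close>, then after about \<open>2 K / (t c)\<close> steps only a difference \<open>U k - V k\<close> of
  order \<open>t K\<close> can be left (lemma \<open>iterations_approach_each_other\<close>). The number of steps depends only
  on \<open>t\<close>, \<open>c\<close> and \<open>K\<close>, so \<open>V\<close> may be any shift of \<open>U\<close>: the sequence is uniformly Cauchy. Taking for
  \<open>V\<close> another iteration shows that the limit does not depend on the initial function.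

  This needs a bound \<open>K\<close> that does not depend on \<open>k\<close>, and admissibility provides it
  (lemma \<open>dpp_iteration_uniformly_bounded\<close>). The chains of length less than \<open>D\<close> that lead out of \<open>Y\<close>
  give a supersolution of the equation: along a chain, the infimum can be estimated by the value at the
  next point, which is closer to the exterior. The bound from below is the bound from above for \<open>- U\<close>.
\<close>

section \<open>Suprema and infima of bounded functions\<close>

lemma abs_SUP_INF_le:
  fixes u :: "'a \<Rightarrow> real"
  assumes "A \<noteq> {}" and "\<And>y. y \<in> A \<Longrightarrow> \<bar>u y\<bar> \<le> K"
  shows "\<bar>SUP y\<in>A. u y\<bar> \<le> K" and "\<bar>INF y\<in>A. u y\<bar> \<le> K"
  using assms by (auto intro!: cSup_abs_le cInf_abs_ge)

lemma bdd_image_if_abs_le: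
  fixes u :: "'a \<Rightarrow> real"
  assumes "\<And>y. y \<in> A \<Longrightarrow> \<bar>u y\<bar> \<le> K"
  shows "bdd_above (u ` A)" and "bdd_below (u ` A)"
  using assms by (auto simp: abs_le_iff intro!: bdd_aboveI2[of _ _ K] bdd_belowI2[of _ "- K"])
    (metis minus_le_iff)

lemma SUP_INF_le_scaled_plus_const:
  fixes u v :: "'a \<Rightarrow> real"
  assumes ne: "A \<noteq> {}" and "l > 0"
    and u: "\<And>y. y \<in> A \<Longrightarrow> \<bar>u y\<bar> \<le> K" and v: "\<And>y. y \<in> A \<Longrightarrow> \<bar>v y\<bar> \<le> K"
    and le: "\<And>y. y \<in> A \<Longrightarrow> u y \<le> l * v y + S"
  shows "(SUP y\<in>A. u y) \<le> l * (SUP y\<in>A. v y) + S"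
    and "(INF y\<in>A. u y) \<le> l * (INF y\<in>A. v y) + S"
proof -
  show "(SUP y\<in>A. u y) \<le> l * (SUP y\<in>A. v y) + S"
  proof (rule cSUP_least[OF ne])
    fix y assume y: "y \<in> A"
    have "v y \<le> (SUP y\<in>A. v y)"
      using y bdd_image_if_abs_le(1)[of A v K] v by (auto intro: cSUP_upper)
    with \<open>l > 0\<close> have "l * v y \<le> l * (SUP y\<in>A. v y)" by simp
    with le[OF y] show "u y \<le> l * (SUP y\<in>A. v y) + S" by simp
  qed
  have "((INF y\<in>A. u y) - S) / l \<le> (INF y\<in>A. v y)"
  proof (rule cINF_greatest[OF ne])
    fix y assume y: "y \<in> A"
    have "(INF y\<in>A. u y) \<le> u y"
      using y bdd_image_if_abs_le(2)[of A u K] u by (auto intro: cINF_lower)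
    with le[OF y] \<open>l > 0\<close> show "((INF y\<in>A. u y) - S) / l \<le> v y"
      by (simp add: field_simps)
  qed
  with \<open>l > 0\<close> show "(INF y\<in>A. u y) \<le> l * (INF y\<in>A. v y) + S"
    by (simp add: field_simps)
qed

section \<open>Uniform boundedness of the iteration\<close>

text \<open>Negation exchanges suprema and infima, and so the weights \<open>\<mu>\<close> and \<open>1 - \<mu>\<close>. Every bound from
  above that holds for all weights and all signs of \<open>f\<close> and \<open>F\<close> is therefore also a bound from below.\<close>

lemma dpp_iteration_uminus:
  assumes "dpp_iteration X Y B \<mu> f F U"
  shows "dpp_iteration X Y B (1 - \<mu>) (\<lambda>x. - f x) (\<lambda>x. - F x) (\<lambda>k x. - U k x)"
proof -
  have "(INF y\<in>A. - u y) = - (SUP y\<in>A. u y)" "(SUP y\<in>A. - u y) = - (INF y\<in>A. u y)"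
    for A :: "'a set" and u :: "'a \<Rightarrow> real"
    by (simp_all add: Inf_real_def image_image)
  with assms show ?thesis
    by (simp add: dpp_iteration_def algebra_simps)
qed

text \<open>This bound depends on \<open>k\<close>. It is needed because suprema and infima of reals can be estimated
  only once the sets are known to be bounded.\<close>

lemma dpp_iteration_bounded_each:
  assumes it: "dpp_iteration X Y B \<mu> f F U"
    and ne: "\<And>x. x \<in> Y \<Longrightarrow> B x \<noteq> {}" and sub: "\<And>x. x \<in> Y \<Longrightarrow> B x \<subseteq> X"
    and \<mu>: "0 < \<mu>" "\<mu> < 1"
    and U0: "\<And>x. x \<in> X \<Longrightarrow> \<bar>U 0 x\<bar> \<le> M"
    and F: "\<And>x. x \<in> X \<Longrightarrow> \<bar>F x\<bar> \<le> M" and f: "\<And>x. x \<in> Y \<Longrightarrow> \<bar>f x\<bar> \<le> C"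
    and "C \<ge> 0"
  shows "x \<in> X \<Longrightarrow> \<bar>U k x\<bar> \<le> M + real k * C"
proof (induction k arbitrary: x)
  case 0
  then show ?case using U0 by simp
next
  case (Suc k)
  show ?case
  proof (cases "x \<in> Y")
    case True
    define K where "K = M + real k * C"
    define s i where "s = (SUP y\<in>B x. U k y)" and "i = (INF y\<in>B x. U k y)"
    have "\<bar>s\<bar> \<le> K" "\<bar>i\<bar> \<le> K"
      unfolding s_def i_def K_def using Suc.IH sub[OF True] ne[OF True]
      by (auto intro!: abs_SUP_INF_le)
    then have "\<bar>\<mu> * s\<bar> \<le> \<mu> * K" "\<bar>(1 - \<mu>) * i\<bar> \<le> (1 - \<mu>) * K"
      using \<mu> by (simp_all add: abs_mult)
    moreover have "U (Suc k) x = \<mu> * s + (1 - \<mu>) * i + f x"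
      using it True by (simp add: dpp_iteration_def s_def i_def)
    ultimately have "\<bar>U (Suc k) x\<bar> \<le> \<mu> * K + (1 - \<mu>) * K + C"
      using f[OF True] by linarith
    then show ?thesis by (simp add: K_def algebra_simps)
  next
    case False
    then have "U (Suc k) x = F x"
      using it Suc.prems by (simp add: dpp_iteration_def)
    moreover have "0 \<le> real (Suc k) * C" using \<open>C \<ge> 0\<close> by simp
    ultimately show ?thesis using F[OF Suc.prems] by linarith
  qed
qed

text \<open>
  A point with a chain of length \<open>n\<close> to the exterior gets the barrier \<open>b n\<close>, where \<open>b\<close> solves
  \<open>b (n + 1) = \<mu> b D + (1 - \<mu>) b n + C\<close> and \<open>b 0 = M\<close>. The recursion is exactly what the induction
  step needs: every point has a chain of length less than \<open>D\<close> and \<open>b\<close> is increasing, so the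
  supremum is at most \<open>b D\<close>, and the infimum is at most the value at the next point of the chain.
\<close>

lemma dpp_iteration_uniformly_bounded_above:
  assumes adm: "admissible X Y B" and it: "dpp_iteration X Y B \<mu> f F U"
    and sub: "\<And>x. x \<in> Y \<Longrightarrow> B x \<subseteq> X"
    and \<mu>: "0 < \<mu>" "\<mu> < 1"
    and U0: "\<And>x. x \<in> X \<Longrightarrow> \<bar>U 0 x\<bar> \<le> M"
    and F: "\<And>x. x \<in> X \<Longrightarrow> \<bar>F x\<bar> \<le> M" and f: "\<And>x. x \<in> Y \<Longrightarrow> \<bar>f x\<bar> \<le> C"
    and "C \<ge> 0"
  shows "\<exists>K. \<forall>k. \<forall>x\<in>X. U k x \<le> K"
proof -
  define chain where "chain x d \<longleftrightarrow> (\<exists>c::nat \<Rightarrow> 'a. (\<forall>i\<le>d. c i \<in> X) \<and> c 0 = x \<and> c d \<in> X - Y \<and>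
    (\<forall>i\<in>{1..d}. c i \<in> B (c (i - 1))))" for x d
  have chain_0: "x \<in> X - Y" if "chain x 0" for x
    using that by (auto simp: chain_def)
  have chain_Suc: "\<exists>y. y \<in> B x \<and> chain y d" if ch: "chain x (Suc d)" for x d
  proof -
    obtain c where "\<forall>i\<le>Suc d. c i \<in> X" "c 0 = x" "c (Suc d) \<in> X - Y"
      and c: "\<forall>i\<in>{1..Suc d}. c i \<in> B (c (i - 1))"
      using ch unfolding chain_def by blast
    moreover have "c (Suc i) \<in> B (c i)" if "i \<le> d" for i
      using bspec[OF c, of "Suc i"] that by simp
    ultimately have "c 1 \<in> B x" "chain (c 1) d"
      unfolding chain_def by (auto intro!: exI[of _ "\<lambda>i. c (Suc i)"] simp: Suc_le_eq)
    then show ?thesis by blast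
  qed
  have ne: "B x \<noteq> {}" if "x \<in> Y" for x
    using adm that by (auto simp: admissible_def)
  obtain D where D: "\<forall>x\<in>Y. \<exists>d<D. chain x d"
    using adm unfolding admissible_def chain_def by blast
  have ex_chain: "\<exists>d\<le>D. chain x d" if "x \<in> X" for x
  proof (cases "x \<in> Y")
    case True
    then show ?thesis using bspec[OF D] less_imp_le by blast
  next
    case False
    then have "chain x 0" unfolding chain_def using that by (intro exI[of _ "\<lambda>_. x"]) simp
    then show ?thesis by blast
  qed
  \<comment> \<open>The general solution with \<open>b 0 = M\<close>; \<open>E\<close> is determined by putting \<open>b D\<close> itself into the recursion.\<close>
  define E where "E = C / (\<mu> * (1 - \<mu>) ^ D)"
  define b where "b n = M + E * (1 - (1 - \<mu>) ^ n)" for n :: nat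
  have "E \<ge> 0" using \<open>C \<ge> 0\<close> \<mu> by (simp add: E_def)
  have b_mono: "b m \<le> b n" if "m \<le> n" for m n
  proof -
    have "(1 - \<mu>) ^ n \<le> (1 - \<mu>) ^ m" using that \<mu> by (intro power_decreasing) auto
    then show ?thesis using \<open>E \<ge> 0\<close> by (simp add: b_def mult_left_mono)
  qed
  have b0: "b 0 = M" by (simp add: b_def)
  have b_rec: "\<mu> * b D + (1 - \<mu>) * b n + C = b (Suc n)" for n
  proof -
    have "E * (\<mu> * (1 - \<mu>) ^ D) = C" using \<mu> by (simp add: E_def)
    then show ?thesis by (simp add: b_def algebra_simps)
  qed
  have main: "U k x \<le> b d" if "chain x d" "d \<le> D" "x \<in> X" for k x d
    using that
  proof (induction k arbitrary: x d)
    case 0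
    then have "U 0 x \<le> M" using U0[of x] by simp
    then show ?case using b_mono[of 0 d] b0 by simp
  next
    case (Suc k)
    show ?case
    proof (cases "x \<in> Y")
      case True
      then obtain m where d: "d = Suc m"
        using chain_0[of x] Suc.prems(1) by (cases d) auto
      then obtain z where z: "z \<in> B x" "chain z m"
        using chain_Suc Suc.prems(1) by blast
      have BX: "y \<in> X" if "y \<in> B x" for y
        using sub[OF True] that by blast
      have bounded: "\<bar>U k y\<bar> \<le> M + real k * C" if "y \<in> B x" for y
        using dpp_iteration_bounded_each[OF it ne sub \<mu> U0 F f \<open>C \<ge> 0\<close> BX[OF that]] by blast
      have "(SUP y\<in>B x. U k y) \<le> b D"
      proof (rule cSUP_least[OF ne[OF True]])
        fix y assume "y \<in> B x"
        then have "y \<in> X" by (rule BX)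
        then obtain n where n: "n \<le> D" "chain y n" using ex_chain by blast
        have "U k y \<le> b n" by (rule Suc.IH[OF n(2,1) \<open>y \<in> X\<close>])
        also have "\<dots> \<le> b D" by (rule b_mono[OF n(1)])
        finally show "U k y \<le> b D" .
      qed
      moreover have "(INF y\<in>B x. U k y) \<le> b m"
      proof -
        have "bdd_below (U k ` B x)" using bounded by (rule bdd_image_if_abs_le(2))
        then have "(INF y\<in>B x. U k y) \<le> U k z" using z(1) by (rule cINF_lower)
        also have "\<dots> \<le> b m" using Suc.IH[OF z(2) _ BX[OF z(1)]] Suc.prems(2) d by simp
        finally show ?thesis .
      qed
      ultimately have "\<mu> * (SUP y\<in>B x. U k y) \<le> \<mu> * b D"
        "(1 - \<mu>) * (INF y\<in>B x. U k y) \<le> (1 - \<mu>) * b m"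
        using \<mu> by simp_all
      moreover have "U (Suc k) x =
          \<mu> * (SUP y\<in>B x. U k y) + (1 - \<mu>) * (INF y\<in>B x. U k y) + f x"
        using it True by (simp add: dpp_iteration_def)
      moreover have "f x \<le> C" using f[OF True] by simp
      ultimately show ?thesis unfolding d using b_rec[of m] by linarith
    next
      case False
      then have "U (Suc k) x = F x"
        using it Suc.prems(3) by (simp add: dpp_iteration_def)
      then show ?thesis using F[OF Suc.prems(3)] b_mono[of 0 d] b0 by simp
    qed
  qed
  have "U k x \<le> b D" if x: "x \<in> X" for k x
  proof -
    obtain d where d: "d \<le> D" "chain x d"
      using ex_chain[OF x] by blast
    have "U k x \<le> b d" by (rule main[OF d(2,1) x])
    also have "\<dots> \<le> b D" by (rule b_mono[OF d(1)])
    finally show ?thesis .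
  qed
  then show ?thesis by blast
qed

lemma dpp_iteration_uniformly_bounded:
  assumes adm: "admissible X Y B" and it: "dpp_iteration X Y B \<mu> f F U"
    and sub: "\<And>x. x \<in> Y \<Longrightarrow> B x \<subseteq> X"
    and \<mu>: "0 < \<mu>" "\<mu> < 1"
    and U0: "\<And>x. x \<in> X \<Longrightarrow> \<bar>U 0 x\<bar> \<le> M"
    and F: "\<And>x. x \<in> X \<Longrightarrow> \<bar>F x\<bar> \<le> M" and f: "\<And>x. x \<in> Y \<Longrightarrow> \<bar>f x\<bar> \<le> C"
    and "C \<ge> 0"
  shows "\<exists>K. \<forall>k. \<forall>x\<in>X. \<bar>U k x\<bar> \<le> K"
proof -
  obtain K1 where K1: "\<And>k x. x \<in> X \<Longrightarrow> U k x \<le> K1"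
    using dpp_iteration_uniformly_bounded_above[OF adm it sub \<mu> U0 F f \<open>C \<ge> 0\<close>] by blast
  have "\<exists>K. \<forall>k. \<forall>x\<in>X. - U k x \<le> K"
    using U0 F f \<mu> \<open>C \<ge> 0\<close>
    by (intro dpp_iteration_uniformly_bounded_above[OF adm dpp_iteration_uminus[OF it] sub]) auto
  then obtain K2 where K2: "\<And>k x. x \<in> X \<Longrightarrow> - U k x \<le> K2" by blast
  have "\<bar>U k x\<bar> \<le> max K1 K2" if "x \<in> X" for k x
    using K1[OF that, of k] K2[OF that, of k] by linarith
  then show ?thesis by blast
qed

section \<open>Comparison of two iterations\<close>

text \<open>
  At a point of \<open>Y\<close>, the right-hand side for \<open>(1 + t) V\<close> has the source \<open>(1 + t) f\<close>, which exceeds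
  \<open>f\<close> by at least \<open>t c\<close>. This is the gain per step in the second argument of the maximum;
  the first argument bounds the difference on the exterior.
\<close>

lemma dpp_iteration_scaled_comparison:
  assumes U: "dpp_iteration X Y B \<mu> f F U" and V: "dpp_iteration X Y B \<mu> f F V"
    and ne: "\<And>x. x \<in> Y \<Longrightarrow> B x \<noteq> {}" and sub: "\<And>x. x \<in> Y \<Longrightarrow> B x \<subseteq> X"
    and \<mu>: "0 < \<mu>" "\<mu> < 1"
    and F: "\<And>x. x \<in> X \<Longrightarrow> \<bar>F x\<bar> \<le> K"
    and UK: "\<And>k x. x \<in> X \<Longrightarrow> \<bar>U k x\<bar> \<le> K" and VK: "\<And>k x. x \<in> X \<Longrightarrow> \<bar>V k x\<bar> \<le> K"
    and f: "\<And>x. x \<in> Y \<Longrightarrow> c \<le> f x" and "c > 0" and "t > 0"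
  shows "x \<in> X \<Longrightarrow> U k x \<le> (1 + t) * V k x + max (t * K) ((2 + t) * K - real k * (t * c))"
proof (induction k arbitrary: x)
  case 0
  have "- K \<le> V 0 x" using VK[OF 0, of 0] by simp
  then have "(1 + t) * - K \<le> (1 + t) * V 0 x"
    using \<open>t > 0\<close> by (intro mult_left_mono) auto
  moreover have "U 0 x \<le> K" using UK[OF 0, of 0] by simp
  ultimately show ?case by (simp add: algebra_simps max_def)
next
  case (Suc k)
  let ?S = "max (t * K) ((2 + t) * K - real k * (t * c))"
  let ?S' = "max (t * K) ((2 + t) * K - real (Suc k) * (t * c))"
  show ?case
  proof (cases "x \<in> Y")
    case True
    let ?sU = "SUP y\<in>B x. U k y" and ?sV = "SUP y\<in>B x. V k y"
    let ?iU = "INF y\<in>B x. U k y" and ?iV = "INF y\<in>B x. V k y"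
    have "?sU \<le> (1 + t) * ?sV + ?S" "?iU \<le> (1 + t) * ?iV + ?S"
      using SUP_INF_le_scaled_plus_const[OF ne[OF True], of "1 + t" "U k" K "V k" ?S]
        Suc.IH UK VK sub[OF True] \<open>t > 0\<close> by (auto simp: subset_iff)
    then have "\<mu> * ?sU \<le> \<mu> * ((1 + t) * ?sV + ?S)"
      "(1 - \<mu>) * ?iU \<le> (1 - \<mu>) * ((1 + t) * ?iV + ?S)"
      using \<mu> by simp_all
    moreover have "U (Suc k) x = \<mu> * ?sU + (1 - \<mu>) * ?iU + f x"
      using U True by (simp add: dpp_iteration_def)
    moreover have "\<mu> * ((1 + t) * ?sV + ?S) + (1 - \<mu>) * ((1 + t) * ?iV + ?S) + f x =
        (1 + t) * V (Suc k) x + ?S - t * f x"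
    proof -
      have v: "V (Suc k) x = \<mu> * ?sV + (1 - \<mu>) * ?iV + f x"
        using V True by (simp add: dpp_iteration_def)
      show ?thesis unfolding v by algebra
    qed
    moreover have "t * c \<le> t * f x" using f[OF True] \<open>t > 0\<close> by simp
    moreover have "?S - t * c \<le> ?S'"
    proof -
      have "0 \<le> t * c" using \<open>t > 0\<close> \<open>c > 0\<close> by simp
      moreover have "real (Suc k) * (t * c) = real k * (t * c) + t * c"
        by (simp add: algebra_simps)
      ultimately show ?thesis unfolding max_def by (auto split: if_splits)
    qed
    ultimately show ?thesis by linarith
  next
    case False
    then have exterior: "U (Suc k) x = F x" "V (Suc k) x = F x"
      using U V Suc.prems by (simp_all add: dpp_iteration_def)
    have "- F x \<le> K" using F[OF Suc.prems] by simp
    then have "t * - F x \<le> t * K" using \<open>t > 0\<close> by (intro mult_left_mono) auto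
    then have "F x \<le> (1 + t) * F x + t * K" by (simp add: algebra_simps)
    moreover have "t * K \<le> ?S'" by simp
    ultimately show ?thesis unfolding exterior by linarith
  qed
qed

text \<open>The bound and the number of steps do not depend on \<open>U\<close> and \<open>V\<close> except through \<open>K\<close>. This is what
  allows \<open>V\<close> to be an arbitrary shift of \<open>U\<close> below.\<close>

lemma iterations_approach_each_other:
  assumes U: "dpp_iteration X Y B \<mu> f F U" and V: "dpp_iteration X Y B \<mu> f F V"
    and ne: "\<And>x. x \<in> Y \<Longrightarrow> B x \<noteq> {}" and sub: "\<And>x. x \<in> Y \<Longrightarrow> B x \<subseteq> X"
    and \<mu>: "0 < \<mu>" "\<mu> < 1"
    and F: "\<And>x. x \<in> X \<Longrightarrow> \<bar>F x\<bar> \<le> K"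
    and UK: "\<And>k x. x \<in> X \<Longrightarrow> \<bar>U k x\<bar> \<le> K" and VK: "\<And>k x. x \<in> X \<Longrightarrow> \<bar>V k x\<bar> \<le> K"
    and f: "\<And>x. x \<in> Y \<Longrightarrow> c \<le> f x" and "c > 0" and "t > 0"
    and k: "2 * K \<le> real k * (t * c)" and x: "x \<in> X"
  shows "\<bar>U k x - V k x\<bar> \<le> 2 * t * K"
proof -
  have m: "max (t * K) ((2 + t) * K - real k * (t * c)) = t * K"
    using k by (simp add: max_def algebra_simps)
  have "U k x \<le> (1 + t) * V k x + t * K"
    using dpp_iteration_scaled_comparison[OF U V ne sub \<mu> F UK VK f \<open>c > 0\<close> \<open>t > 0\<close> x, of k] m
    by simp
  moreover have "V k x \<le> (1 + t) * U k x + t * K"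
    using dpp_iteration_scaled_comparison[OF V U ne sub \<mu> F VK UK f \<open>c > 0\<close> \<open>t > 0\<close> x, of k] m
    by simp
  moreover have "t * V k x \<le> t * K" "t * U k x \<le> t * K"
    using UK[OF x, of k] VK[OF x, of k] \<open>t > 0\<close> by (auto intro!: mult_left_mono)
  ultimately show ?thesis by (simp add: algebra_simps abs_le_iff)
qed

lemma iterations_uniformly_close:
  fixes e :: real
  assumes ne: "\<And>x. x \<in> Y \<Longrightarrow> B x \<noteq> {}" and sub: "\<And>x. x \<in> Y \<Longrightarrow> B x \<subseteq> X"
    and \<mu>: "0 < \<mu>" "\<mu> < 1"
    and F: "\<And>x. x \<in> X \<Longrightarrow> \<bar>F x\<bar> \<le> K"
    and f: "\<And>x. x \<in> Y \<Longrightarrow> c \<le> f x" and "c > 0" and "K \<ge> 0" and "e > 0"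
  shows "\<exists>N. \<forall>U V. dpp_iteration X Y B \<mu> f F U \<longrightarrow> dpp_iteration X Y B \<mu> f F V \<longrightarrow>
           (\<forall>k. \<forall>x\<in>X. \<bar>U k x\<bar> \<le> K \<and> \<bar>V k x\<bar> \<le> K) \<longrightarrow>
           (\<forall>k\<ge>N. \<forall>x\<in>X. \<bar>U k x - V k x\<bar> < e)"
proof -
  \<comment> \<open>The summand \<open>1\<close> covers \<open>K = 0\<close>.\<close>
  define t where "t = e / (2 * K + 1)"
  have t: "t > 0" "2 * t * K < e"
    using \<open>K \<ge> 0\<close> \<open>e > 0\<close> by (simp_all add: t_def field_simps)
  have tc: "t * c > 0" using t \<open>c > 0\<close> by simp
  obtain N :: nat where N: "2 * K < real N * (t * c)"
    using reals_Archimedean3[OF tc] by blast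
  show ?thesis
  proof (intro exI allI ballI impI)
    fix U V :: "nat \<Rightarrow> 'a \<Rightarrow> real" and k x
    assume it: "dpp_iteration X Y B \<mu> f F U" "dpp_iteration X Y B \<mu> f F V"
      and "\<forall>k. \<forall>x\<in>X. \<bar>U k x\<bar> \<le> K \<and> \<bar>V k x\<bar> \<le> K" and "k \<ge> N" and x: "x \<in> X"
    then have bd: "\<And>k x. x \<in> X \<Longrightarrow> \<bar>U k x\<bar> \<le> K" "\<And>k x. x \<in> X \<Longrightarrow> \<bar>V k x\<bar> \<le> K"
      by simp_all
    have "real N * (t * c) \<le> real k * (t * c)"
      using \<open>k \<ge> N\<close> tc by (intro mult_right_mono) auto
    with N have k: "2 * K \<le> real k * (t * c)" by simp
    show "\<bar>U k x - V k x\<bar> < e"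
      using iterations_approach_each_other[OF it ne sub \<mu> F bd f \<open>c > 0\<close> t(1) k x] t(2) by simp
  qed
qed

section \<open>Uniform convergence\<close>

lemma dpp_iteration_shift:
  assumes "dpp_iteration X Y B \<mu> f F U"
  shows "dpp_iteration X Y B \<mu> f F (\<lambda>k. U (k + m))"
  using assms by (simp add: dpp_iteration_def)

text \<open>The limit of one bounded iteration serves for all of them. If no bounded iteration existed, any
  function would do.\<close>

theorem dpp_iteration_uniform_limit:
  fixes f F :: "'a \<Rightarrow> real"
  assumes adm: "admissible X Y B" and sub: "\<And>x. x \<in> Y \<Longrightarrow> B x \<subseteq> X" and "Y \<subseteq> X"
    and \<mu>: "0 < \<mu>" "\<mu> < 1"
    and bF: "bdd_above ((\<lambda>x. \<bar>F x\<bar>) ` X)" and bf: "bdd_above ((\<lambda>x. \<bar>f x\<bar>) ` X)"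
    and pos: "(INF x\<in>Y. f x) > 0"
  shows "\<exists>u. \<forall>U. bdd_above ((\<lambda>x. \<bar>U 0 x\<bar>) ` X) \<longrightarrow> dpp_iteration X Y B \<mu> f F U \<longrightarrow>
           uniform_limit X U u sequentially"
proof -
  define c where "c = (INF x\<in>Y. f x)"
  have "c > 0" using pos by (simp add: c_def)
  have ne: "B x \<noteq> {}" if "x \<in> Y" for x
    using adm that by (auto simp: admissible_def)
  obtain C where C: "\<And>x. x \<in> X \<Longrightarrow> \<bar>f x\<bar> \<le> C"
    using bf by (auto simp: bdd_above_def)
  obtain L where L: "\<And>x. x \<in> X \<Longrightarrow> \<bar>F x\<bar> \<le> L"
    using bF by (auto simp: bdd_above_def)
  obtain x0 where x0: "x0 \<in> X" using adm by (auto simp: admissible_def)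
  have "C \<ge> 0" using C[OF x0] by simp
  have f_ge: "c \<le> f x" if "x \<in> Y" for x
    unfolding c_def using that C \<open>Y \<subseteq> X\<close> by (intro cINF_lower bdd_image_if_abs_le(2)) auto
  have bound: "\<exists>K. \<forall>k. \<forall>x\<in>X. \<bar>U k x\<bar> \<le> K"
    if b0: "bdd_above ((\<lambda>x. \<bar>U 0 x\<bar>) ` X)" and it: "dpp_iteration X Y B \<mu> f F U" for U
  proof -
    obtain M where M: "\<And>x. x \<in> X \<Longrightarrow> \<bar>U 0 x\<bar> \<le> M"
      using b0 by (auto simp: bdd_above_def)
    show ?thesis
      using M L C \<open>Y \<subseteq> X\<close> \<open>C \<ge> 0\<close>
      by (intro dpp_iteration_uniformly_bounded[OF adm it sub \<mu>, of "max M L" C])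
        (auto simp: le_max_iff_disj)
  qed
  show ?thesis
  proof (cases "\<exists>V. bdd_above ((\<lambda>x. \<bar>V 0 x\<bar>) ` X) \<and> dpp_iteration X Y B \<mu> f F V")
    case False
    then show ?thesis by blast
  next
    case True
    then obtain V where V: "bdd_above ((\<lambda>x. \<bar>V 0 x\<bar>) ` X)" "dpp_iteration X Y B \<mu> f F V"
      by blast
    obtain KV where KV: "\<And>k x. x \<in> X \<Longrightarrow> \<bar>V k x\<bar> \<le> KV"
      using bound[OF V] by blast
    have "uniformly_convergent_on X V"
    proof (rule Cauchy_uniformly_convergent, rule uniformly_Cauchy_onI')
      fix e :: real assume "e > 0"
      define K where "K = max L KV"
      have FK: "\<bar>F x\<bar> \<le> K" and VK: "\<bar>V k x\<bar> \<le> K" if "x \<in> X" for k x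
        using L[OF that] KV[OF that, of k] by (auto simp: K_def)
      have "K \<ge> 0" using FK[OF x0] by simp
      obtain N where N: "\<forall>U W. dpp_iteration X Y B \<mu> f F U \<longrightarrow> dpp_iteration X Y B \<mu> f F W \<longrightarrow>
          (\<forall>k. \<forall>x\<in>X. \<bar>U k x\<bar> \<le> K \<and> \<bar>W k x\<bar> \<le> K) \<longrightarrow> (\<forall>k\<ge>N. \<forall>x\<in>X. \<bar>U k x - W k x\<bar> < e)"
        using iterations_uniformly_close[OF ne sub \<mu> FK f_ge \<open>c > 0\<close> \<open>K \<ge> 0\<close> \<open>e > 0\<close>]
        by (rule exE)
      have close: "\<bar>V k x - V (k + j) x\<bar> < e" if "k \<ge> N" "x \<in> X" for k j x
        using N[rule_format, OF V(2) dpp_iteration_shift[OF V(2), of j]] VK that by simp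
      show "\<exists>N. \<forall>x\<in>X. \<forall>m\<ge>N. \<forall>n>m. dist (V m x) (V n x) < e"
      proof (intro exI ballI allI impI)
        fix x m n assume "x \<in> X" "m \<ge> N" "n > m"
        then show "dist (V m x) (V n x) < e"
          using close[of m x "n - m"] by (simp add: dist_real_def)
      qed
    qed
    then obtain u where u: "uniform_limit X V u sequentially"
      by (auto simp: uniformly_convergent_on_def)
    have "uniform_limit X U u sequentially"
      if U: "bdd_above ((\<lambda>x. \<bar>U 0 x\<bar>) ` X)" "dpp_iteration X Y B \<mu> f F U" for U
    proof -
      obtain KU where KU: "\<And>k x. x \<in> X \<Longrightarrow> \<bar>U k x\<bar> \<le> KU"
        using bound[OF U] by blast
      define K where "K = max L (max KU KV)"
      have FK: "\<bar>F x\<bar> \<le> K" and UK: "\<bar>U k x\<bar> \<le> K" and VK: "\<bar>V k x\<bar> \<le> K" if "x \<in> X" for k x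
        using L[OF that] KU[OF that, of k] KV[OF that, of k] by (auto simp: K_def)
      have "K \<ge> 0" using FK[OF x0] by simp
      have "uniform_limit X (\<lambda>k x. U k x - V k x) (\<lambda>x. 0) sequentially"
      proof (rule uniform_limitI)
        fix e :: real assume "e > 0"
        obtain N where N: "\<forall>U W. dpp_iteration X Y B \<mu> f F U \<longrightarrow> dpp_iteration X Y B \<mu> f F W \<longrightarrow>
            (\<forall>k. \<forall>x\<in>X. \<bar>U k x\<bar> \<le> K \<and> \<bar>W k x\<bar> \<le> K) \<longrightarrow> (\<forall>k\<ge>N. \<forall>x\<in>X. \<bar>U k x - W k x\<bar> < e)"
          using iterations_uniformly_close[OF ne sub \<mu> FK f_ge \<open>c > 0\<close> \<open>K \<ge> 0\<close> \<open>e > 0\<close>]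
          by (rule exE)
        have "\<bar>U k x - V k x\<bar> < e" if "k \<ge> N" "x \<in> X" for k x
          using N[rule_format, OF U(2) V(2)] UK VK that by simp
        then show "\<forall>\<^sub>F k in sequentially. \<forall>x\<in>X. dist (U k x - V k x) 0 < e"
          by (auto simp: eventually_sequentially)
      qed
      from uniform_limit_add[OF this u] show ?thesis by simp
    qed
    then show ?thesis by blast
  qed
qed

theorem theorem2:
  fixes X Y :: "'a set" and \<rho> :: "'a \<Rightarrow> 'a \<Rightarrow> real"
    and \<epsilon> \<mu> :: real and f F :: "'a \<Rightarrow> real"
  assumes "Metric_space X \<rho>"
    and "Metric_space.mbounded X \<rho> X"
    and "Y \<subset> X" and "Y \<noteq> {}"
    and "\<epsilon> > 0"
    and "admissible X Y (\<lambda>x. Metric_space.mball X \<rho> x \<epsilon>)"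
    and "0 < \<mu>" and "\<mu> < 1"
    and "bdd_above ((\<lambda>x. \<bar>F x\<bar>) ` X)"
    and "bdd_above ((\<lambda>x. \<bar>f x\<bar>) ` X)"
    and "(INF x\<in>Y. f x) > 0"
  shows "\<exists>u :: 'a \<Rightarrow> real. \<forall>U :: nat \<Rightarrow> 'a \<Rightarrow> real.
           bdd_above ((\<lambda>x. \<bar>U 0 x\<bar>) ` X) \<longrightarrow>
           dpp_iteration X Y (\<lambda>x. Metric_space.mball X \<rho> x \<epsilon>) \<mu> f F U \<longrightarrow>
           uniform_limit X U u sequentially"
proof (rule dpp_iteration_uniform_limit)
  show "Metric_space.mball X \<rho> x \<epsilon> \<subseteq> X" for x
    by (rule Metric_space.mball_subset_mspace[OF assms(1)])
  show "Y \<subseteq> X" using assms(3) by blast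
qed (use assms in auto)

end
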